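(* Let $r$ be a positive integer. Take any 2-colouring of the edges of $\vec{K}_{\mathbb{N}}$ (with colours red and blue) in which there are no red directed paths of length $r$ and every blue directed path has upper density at most $\frac{1}{r}$. Then there exists a finite set of vertices $U\subseteq\mathbb{N}$ such that the 2-colouring induced on $\mathbb{N}\setminus U$ is isomorphic to the 2-colouring $c_r$ of $\vec{K}_{\mathbb{N}}$.
   Context: $\mathbb{N}$ denotes the set of positive integers. $\vec{K}_{\mathbb{N}}$ is the complete symmetric digraph on $\mathbb{N}$: its vertex set is $\mathbb{N}$ and for every pair of distinct $m,n\in\mathbb{N}$ both directed edges $(m,n)$ (from $m$ to $n$) and $(n,m)$ are present. A $k$-colouring of $\vec{K}_{\mathbb{N}}$ is an assignment of one of $k$ colours to each directed edge (so $(m,n)$ and $(n,m)$ may receive different colours); in a 2-colouring the colours are red and blue. A path $P=v_1v_2\dots$ in $\vec{K}_{\mathbb{N}}$ is a finite or (one-way) infinite sequence of distinct vertices together with, for each pair of consecutive vertices, one of the two directed edges joining them. $P$ is a directed path if all its edges are oriented in the same direction along $P$. The length of a path is its number of edges. A path is red (respectively blue) if all of its edges are red (respectively blue). The upper density of a set $A\subseteq\mathbb{N}$ is $\bar d(A)=\limsup_{n\to\infty}\frac{|A\cap\{1,\dots,n\}|}{n}$, and the upper density of a path is the upper density of its vertex set. The 2-colouring $c_r$ of $\vec{K}_{\mathbb{N}}$ is defined as follows. Partition $\mathbb{N}$ into sets $A_1,\dots,A_r$, where $n\in A_i$ if and only if $n\equiv i \pmod r$. For distinct $m,n\in\mathbb{N}$: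 if $m,n$ lie in the same set $A_i$, then both $(m,n)$ and $(n,m)$ are blue; if $m\in A_i$, $n\in A_j$ and $i<j$, then $(m,n)$ is blue and $(n,m)$ is red. Two 2-coloured complete symmetric digraphs are isomorphic if there is a bijection $\varphi$ between their vertex sets such that, for all distinct vertices $x,y$, the edge $(x,y)$ has the same colour as the edge $(\varphi(x),\varphi(y))$. *)

theory Defs
  imports
    "HOL-Library.Extended_Real"
    "HOL-Library.Liminf_Limsup"
    "HOL-Number_Theory.Cong"
begin

datatype colour = Red | Blue

definition KN_verts :: "nat set"
  where "KN_verts = {1..}"

definition KN_edges :: "(nat \<times> nat) set"
  where "KN_edges = {(m, n). m \<in> KN_verts \<and> n \<in> KN_verts \<and> m \<noteq> n}"

text \<open>
  A 2-colouring is a function on ordered pairs; only its values on \<^const>\<open>KN_edges\<close> ever matter.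
\<close>

type_synonym colouring = "nat \<times> nat \<Rightarrow> colour"

text \<open>
  A finite or one-way infinite path. The length counts edges, so the vertices are
  \<open>pvert P i\<close> for \<open>i \<le> plength P\<close> and the edges are \<open>pedge P i\<close> for \<open>i < plength P\<close>, where
  \<open>pedge P i\<close> joins \<open>pvert P i\<close> and \<open>pvert P (Suc i)\<close> in either direction. Values outside
  these index ranges are junk.
\<close>

record dpath =
  plength :: enat
  pvert :: "nat \<Rightarrow> nat"
  pedge :: "nat \<Rightarrow> nat \<times> nat"

definition path_verts :: "dpath \<Rightarrow> nat set"
  where "path_verts P = pvert P ` {i. enat i \<le> plength P}"

definition is_path :: "dpath \<Rightarrow> bool"
  where "is_path P \<longleftrightarrow>
    path_verts P \<subseteq> KN_verts \<and>
    inj_on (pvert P) {i. enat i \<le> plength P} \<and>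
    (\<forall>i. enat i < plength P \<longrightarrow>
      pedge P i \<in> KN_edges \<and>
      pedge P i \<in> {(pvert P i, pvert P (Suc i)), (pvert P (Suc i), pvert P i)})"

text \<open>
  An infinite directed path may be oriented away from its first vertex or towards it.
\<close>

definition directed_path :: "dpath \<Rightarrow> bool"
  where "directed_path P \<longleftrightarrow> is_path P \<and>
    ((\<forall>i. enat i < plength P \<longrightarrow> pedge P i = (pvert P i, pvert P (Suc i))) \<or>
     (\<forall>i. enat i < plength P \<longrightarrow> pedge P i = (pvert P (Suc i), pvert P i)))"

definition path_has_colour :: "colouring \<Rightarrow> colour \<Rightarrow> dpath \<Rightarrow> bool"
  where "path_has_colour c x P \<longleftrightarrow> (\<forall>i. enat i < plength P \<longrightarrow> c (pedge P i) = x)"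

definition upper_density :: "nat set \<Rightarrow> ereal"
  where "upper_density A = limsup (\<lambda>n. ereal (real (card (A \<inter> {1..n})) / real n))"

definition residue_part :: "nat \<Rightarrow> nat \<Rightarrow> nat set"
  where "residue_part r i = {n \<in> KN_verts. [n = i] (mod r)}"

text \<open>
  The parts are indexed by \<open>1, \<dots>, r\<close>, so the multiples of \<open>r\<close> form the last part. An edge of
  \<open>c_r\<close> is red exactly if it goes from a part to one of strictly smaller index.
\<close>

definition c_r :: "nat \<Rightarrow> colouring"
  where "c_r r = (\<lambda>(m, n).
    if \<exists>i\<in>{1..r}. \<exists>j\<in>{1..r}. m \<in> residue_part r j \<and> n \<in> residue_part r i \<and> i < j
    then Red else Blue)"

text \<open>
  Isomorphism of the complete symmetric digraphs on \<open>V\<close> and \<open>W\<close>, coloured by (the restrictions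
  of) \<open>c\<close> and \<open>d\<close>.
\<close>

definition colour_isomorphic ::
    "nat set \<Rightarrow> colouring \<Rightarrow> nat set \<Rightarrow> colouring \<Rightarrow> bool"
  where "colour_isomorphic V c W d \<longleftrightarrow>
    (\<exists>\<phi>. bij_betw \<phi> V W \<and>
      (\<forall>x\<in>V. \<forall>y\<in>V. x \<noteq> y \<longrightarrow> c (x, y) = d (\<phi> x, \<phi> y)))"

end

theory Submission
  imports Defs "HOL-Library.Infinite_Set" "HOL-Library.Disjoint_Sets"
begin

text \<open>
  A proper vertex colouring of the red digraph with \<open>r\<close> colours exists because the red digraph has
  no directed path with \<open>r\<close> edges; this is the Gallai--Roy theorem (\<open>gallai_roy\<close>). Its colour
  classes are complete in blue.

  The density hypothesis then acts only through a counting argument (\<open>density_cover\<close>): up to a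
  finite set, the positive integers are not covered by fewer than \<open>r\<close> sets of upper density at most
  \<open>1 / r\<close>. Each infinite class is the vertex set of a blue ray, so all \<open>r\<close> classes are infinite, and
  no blue ray runs through exactly the union of two classes. But if, outside every finite set, blue
  edges went both ways between two classes, then a blue ray could switch between these classes
  as often as needed to exhaust both (\<open>crossing_ray\<close>). Hence, after deletion of a
  finite set, any two classes have all edges red in at least one of the two directions.

  What remains is a blow-up of a red tournament on \<open>r\<close> vertices with infinite parts
  (\<open>red_blowup_is_transitive\<close>). A cycle in the tournament would yield arbitrarily long red paths, so
  the tournament is a linear order. A single red edge against that order could be inserted into
  a red path that descends through all the parts, and the result would have more than \<open>r\<close> vertices.
  So the colouring is the one of \<open>c_r\<close>, with all parts countably infinite, and any choice of
  bijections between the corresponding parts is an isomorphism (\<open>colour_isomorphic_c_rI\<close>).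
\<close>

section \<open>Finite directed paths\<close>

definition dipath :: "'a rel \<Rightarrow> 'a list \<Rightarrow> bool"
  where "dipath E p \<longleftrightarrow> distinct p \<and> successively (\<lambda>x y. (x, y) \<in> E) p"

lemma dipath_append:
  "dipath E (p @ q) \<longleftrightarrow> dipath E p \<and> dipath E q \<and> set p \<inter> set q = {} \<and>
    (p = [] \<or> q = [] \<or> (last p, hd q) \<in> E)"
  by (auto simp: dipath_def successively_append_iff)

lemma successively_nthD: "successively P p \<Longrightarrow> Suc i < length p \<Longrightarrow> P (p ! i) (p ! Suc i)"
proof (induction p arbitrary: i)
  case (Cons x p)
  then show ?case by (cases i; cases p) auto
qed simp

lemma successively_map_upt:
  "(\<And>i. i < n \<Longrightarrow> P (s i) (s (Suc i))) \<Longrightarrow> successively P (map s [0..<Suc n])"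
proof (induction n)
  case (Suc n)
  have "successively P (map s [0..<Suc n] @ [s (Suc n)])"
    using Suc by (subst successively_append_iff) (auto simp: last_map)
  then show ?case by simp
qed simp

section \<open>The Gallai--Roy theorem\<close>

lemma trancl_Union_chainD:
  assumes "(x, y) \<in> (\<Union>C)\<^sup>+" and "subset.chain A C"
  shows "\<exists>R\<in>C. (x, y) \<in> R\<^sup>+"
  using assms(1)
proof induction
  case (base y)
  then show ?case by blast
next
  case (step y z)
  then obtain R S where RS: "R \<in> C" "(x, y) \<in> R\<^sup>+" "S \<in> C" "(y, z) \<in> S" by blast
  with assms(2) have "R \<subseteq> S \<or> S \<subseteq> R" by (auto simp: subset_chain_def)
  with RS show ?case by (meson subsetD trancl.trancl_into_trancl trancl_mono)
qed

text \<open>An edge that cannot be added to a maximal acyclic subrelation would close a cycle.\<close>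

lemma maximal_acyclic_subrelation:
  "\<exists>D\<subseteq>E. acyclic D \<and> (\<forall>(u, v)\<in>E - D. (v, u) \<in> D\<^sup>*)"
proof -
  let ?A = "{D. D \<subseteq> E \<and> acyclic D}"
  have "\<exists>D\<in>?A. \<forall>X\<in>?A. D \<subseteq> X \<longrightarrow> X = D"
  proof (rule subset_Zorn')
    fix C assume C: "subset.chain ?A C"
    have sub: "R \<subseteq> E \<and> acyclic R" if "R \<in> C" for R
      using C that unfolding subset_chain_def by blast
    have "acyclic (\<Union>C)"
    proof (rule acyclicI, intro allI notI)
      fix x assume "(x, x) \<in> (\<Union>C)\<^sup>+"
      from trancl_Union_chainD[OF this C] obtain R where "R \<in> C" "(x, x) \<in> R\<^sup>+" by (rule bexE)
      with sub show False unfolding acyclic_def by metis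
    qed
    moreover have "\<Union>C \<subseteq> E" using sub by (meson Sup_least)
    ultimately show "\<Union>C \<in> ?A" by simp
  qed
  then obtain D where "D \<in> ?A" and max: "\<forall>X\<in>?A. D \<subseteq> X \<longrightarrow> X = D" by (rule bexE)
  then have D: "D \<subseteq> E" "acyclic D" by simp_all
  have "(v, u) \<in> D\<^sup>*" if "(u, v) \<in> E - D" for u v
  proof (rule ccontr)
    assume "(v, u) \<notin> D\<^sup>*"
    with that D have "insert (u, v) D \<in> ?A" by simp
    with max have "insert (u, v) D = D" by blast
    with that show False by blast
  qed
  then show ?thesis using D by (intro exI[of _ D]) auto
qed

text \<open>In an acyclic relation every walk is a path.\<close>

lemma acyclic_relpow_bound:
  assumes "acyclic D" and bound: "\<And>p. dipath D p \<Longrightarrow> length p \<le> r" and "(u, v) \<in> D ^^ n"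
  shows "n < r"
proof -
  obtain s where s: "\<And>i. i < n \<Longrightarrow> (s i, s (Suc i)) \<in> D"
    using assms(3) by (auto simp: relpow_fun_conv)
  have step: "(s i, s j) \<in> D\<^sup>+" if "i < j" "j \<le> n" for i j
    using that
  proof (induction j)
    case (Suc j)
    then show ?case
      using s[of j] by (cases "i = j") (auto intro: trancl.trancl_into_trancl)
  qed simp
  have "inj_on s {0..<Suc n}"
  proof (rule linorder_inj_onI')
    fix i j assume "i \<in> {0..<Suc n}" "j \<in> {0..<Suc n}" "i < j"
    then show "s i \<noteq> s j" using step[of i j] \<open>acyclic D\<close> by (auto simp: acyclic_def)
  qed
  then have "dipath D (map s [0..<Suc n])"
    unfolding dipath_def
    using successively_map_upt[of n "\<lambda>x y. (x, y) \<in> D" s] s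
    by (simp del: upt_Suc add: distinct_map)
  from bound[OF this] show ?thesis by simp
qed

text \<open>
  The colour of a vertex is the length of a longest walk that ends there and runs in a maximal
  acyclic subrelation \<open>D\<close>. It strictly increases along the edges of \<open>D\<close>, and every other edge points
  backwards along a walk of \<open>D\<close>.
\<close>

lemma gallai_roy:
  fixes E :: "'a rel"
  assumes "irrefl E" and bound: "\<And>p. dipath E p \<Longrightarrow> length p \<le> r"
  shows "\<exists>f::'a \<Rightarrow> nat. (\<forall>v. f v < r) \<and> (\<forall>(u, v)\<in>E. f u \<noteq> f v)"
proof -
  obtain D where D: "D \<subseteq> E" "acyclic D" and backward: "\<And>u v. (u, v) \<in> E - D \<Longrightarrow> (v, u) \<in> D\<^sup>*"
    using maximal_acyclic_subrelation[of E] by blast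
  have boundD: "length p \<le> r" if "dipath D p" for p
    using that D(1) by (intro bound) (auto simp: dipath_def intro: successively_mono)
  have n_less: "n < r" if "(u, v) \<in> D ^^ n" for u v n
    by (rule acyclic_relpow_bound[OF D(2) _ that]) (rule boundD)
  define f where "f v = (GREATEST n. \<exists>u. (u, v) \<in> D ^^ n)" for v
  have attained: "\<exists>u. (u, v) \<in> D ^^ f v" for v
    unfolding f_def
    by (rule GreatestI_nat[of _ 0 r]) (auto dest: n_less)
  have f_ge: "n \<le> f v" if "(u, v) \<in> D ^^ n" for u v n
    unfolding f_def
    by (rule Greatest_le_nat[of _ _ r]) (use that in \<open>auto dest: n_less\<close>)
  have f_step: "f u < f v" if "(u, v) \<in> D" for u v
  proof -
    obtain w where "(w, u) \<in> D ^^ f u" using attained by blast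
    with that have "(w, v) \<in> D ^^ Suc (f u)" by auto
    from f_ge[OF this] show ?thesis by simp
  qed
  have f_trancl: "f u < f v" if "(u, v) \<in> D\<^sup>+" for u v
    using that by induction (auto dest: f_step)
  have "f u \<noteq> f v" if "(u, v) \<in> E" for u v
  proof (cases "(u, v) \<in> D")
    case False
    with that backward have "(v, u) \<in> D\<^sup>*" by blast
    moreover have "u \<noteq> v" using that \<open>irrefl E\<close> by (auto simp: irrefl_def)
    ultimately show ?thesis using f_trancl[of v u] by (auto simp: rtrancl_eq_or_trancl)
  qed (use f_step in force)
  moreover have "f v < r" for v using attained n_less by blast
  ultimately show ?thesis by blast
qed

section \<open>Rays that exhaust one or two classes\<close>

text \<open>
  The ray is the limit of a chain of finite paths, the \<open>n\<close>-th of which is extended so as to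
  contain \<open>n\<close>.
\<close>

lemma exhausting_ray:
  fixes S :: "nat set"
  assumes "infinite S" and "good []"
    and good: "\<And>p. good p \<Longrightarrow> dipath E p \<and> set p \<subseteq> S"
    and extend: "\<And>p t. good p \<Longrightarrow> t \<in> S \<Longrightarrow> \<exists>q. good (p @ q) \<and> t \<in> set (p @ q)"
  shows "\<exists>h. inj h \<and> range h = S \<and> (\<forall>i. (h i, h (Suc i)) \<in> E)"
proof -
  have "\<exists>g. \<forall>n. good (g n) \<and> ((\<exists>q. g (Suc n) = g n @ q) \<and> (n \<in> S \<longrightarrow> n \<in> set (g (Suc n))))"
  proof (rule dependent_nat_choice)
    show "\<exists>p. good p" using \<open>good []\<close> by blast
    show "\<exists>p'. good p' \<and> ((\<exists>q. p' = p @ q) \<and> (n \<in> S \<longrightarrow> n \<in> set p'))" if "good p" for p n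
    proof (cases "n \<in> S")
      case True
      with extend[OF that] show ?thesis by blast
    next
      case False
      then show ?thesis using that by (intro exI[of _ p]) auto
    qed
  qed
  then obtain g where g: "\<And>n. good (g n)" and ext: "\<And>n. \<exists>q. g (Suc n) = g n @ q"
    and hit: "\<And>n. n \<in> S \<Longrightarrow> n \<in> set (g (Suc n))" by blast
  have prefix: "\<exists>q. g n = g m @ q" if "m \<le> n" for m n
    using that
  proof (induction n rule: dec_induct)
    case (step n)
    then show ?case using ext[of n] by (metis append.assoc)
  qed simp
  have long: "\<exists>n. i < length (g n)" for i
  proof -
    obtain T where T: "T \<subseteq> S" "finite T" "card T = Suc i"
      using infinite_arbitrarily_large[OF \<open>infinite S\<close>] by blast
    have "T \<subseteq> set (g (Suc (Max T)))"
    proof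
      fix t assume "t \<in> T"
      then have "Suc t \<le> Suc (Max T)" using T by simp
      then obtain q where "g (Suc (Max T)) = g (Suc t) @ q" using prefix by blast
      then show "t \<in> set (g (Suc (Max T)))" using hit[of t] \<open>t \<in> T\<close> T(1) by auto
    qed
    then have "Suc i \<le> length (g (Suc (Max T)))"
      using T(3) card_mono[of "set (g (Suc (Max T)))" T] card_length[of "g (Suc (Max T))"] by simp
    then show ?thesis using Suc_le_lessD by blast
  qed
  define h where "h i = g (SOME n. i < length (g n)) ! i" for i
  have h: "h i = g n ! i" if "i < length (g n)" for i n
  proof -
    let ?m = "SOME n. i < length (g n)"
    have "i < length (g ?m)" using someI_ex[OF long] .
    then show ?thesis
      unfolding h_def using that prefix[of n ?m] prefix[of ?m n] nle_le[of n ?m]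
      by (auto simp: nth_append)
  qed
  have common: "\<exists>n. i < length (g n) \<and> j < length (g n)" for i j
    using long[of "max i j"] by auto
  have "inj h"
  proof (rule injI)
    fix i j assume eq: "h i = h j"
    obtain n where "i < length (g n)" "j < length (g n)" using common by blast
    with eq good[OF g[of n]] show "i = j" by (simp add: h dipath_def nth_eq_iff_index_eq)
  qed
  moreover have "range h = S"
  proof
    show "range h \<subseteq> S"
    proof
      fix x assume "x \<in> range h"
      then obtain i where i: "x = h i" by blast
      obtain n where "i < length (g n)" using long by blast
      with i good[OF g[of n]] show "x \<in> S" by (auto simp: h)
    qed
    show "S \<subseteq> range h"
    proof
      fix t assume "t \<in> S"
      from hit[OF this] obtain i where "i < length (g (Suc t))" "t = g (Suc t) ! i"
        by (auto simp: in_set_conv_nth)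
      then show "t \<in> range h" using h by (metis rangeI)
    qed
  qed
  moreover have "(h i, h (Suc i)) \<in> E" for i
  proof -
    obtain n where "i < length (g n)" "Suc i < length (g n)" using common by blast
    with good[OF g[of n]] show ?thesis
      using successively_nthD[of "\<lambda>x y. (x, y) \<in> E" "g n" i] h[of i n] h[of "Suc i" n]
      by (auto simp: dipath_def)
  qed
  ultimately show ?thesis by blast
qed

text \<open>
  A finite path that ends in \<open>X\<close> can make an excursion into \<open>Y\<close>: it crosses by an edge \<open>(a, b)\<close> that
  avoids everything used so far, visits the prescribed vertex of \<open>Y\<close>, and returns to \<open>X\<close> by another
  unused edge. The case \<open>X = Y\<close> is included.
\<close>

lemma crossing_ray:
  fixes X Y :: "nat set"
  assumes "infinite X" and "irrefl E"
    and EX: "\<And>x y. x \<in> X \<Longrightarrow> y \<in> X \<Longrightarrow> x \<noteq> y \<Longrightarrow> (x, y) \<in> E"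
    and EY: "\<And>x y. x \<in> Y \<Longrightarrow> y \<in> Y \<Longrightarrow> x \<noteq> y \<Longrightarrow> (x, y) \<in> E"
    and XY: "\<And>F. finite F \<Longrightarrow> \<exists>x\<in>X - F. \<exists>y\<in>Y - F. (x, y) \<in> E"
    and YX: "\<And>F. finite F \<Longrightarrow> \<exists>y\<in>Y - F. \<exists>x\<in>X - F. (y, x) \<in> E"
  shows "\<exists>h. inj h \<and> range h = X \<union> Y \<and> (\<forall>i. (h i, h (Suc i)) \<in> E)"
proof (rule exhausting_ray[where good =
      "\<lambda>p. dipath E p \<and> set p \<subseteq> X \<union> Y \<and> (p \<noteq> [] \<longrightarrow> last p \<in> X)"])
  show "infinite (X \<union> Y)" using \<open>infinite X\<close> by simp
next
  fix p t
  assume p: "dipath E p \<and> set p \<subseteq> X \<union> Y \<and> (p \<noteq> [] \<longrightarrow> last p \<in> X)" and t: "t \<in> X \<union> Y"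
  have last_p: "(last p, a) \<in> E" if "p \<noteq> []" "a \<in> X" "a \<notin> set p" for a
  proof (rule EX)
    show "last p \<noteq> a" using that last_in_set by blast
  qed (use p that in auto)
  consider "t \<in> set p" | "t \<notin> set p" "t \<in> X" | "t \<notin> set p" "t \<in> Y" using t by blast
  then show "\<exists>q. (dipath E (p @ q) \<and> set (p @ q) \<subseteq> X \<union> Y \<and> (p @ q \<noteq> [] \<longrightarrow> last (p @ q) \<in> X)) \<and>
      t \<in> set (p @ q)"
  proof cases
    case 1
    then show ?thesis using p by (intro exI[of _ "[]"]) simp
  next
    case 2
    then show ?thesis
      using p last_p by (intro exI[of _ "[t]"]) (auto simp: dipath_append, auto simp: dipath_def)
  next
    case 3
    obtain a b where ab: "a \<in> X" "b \<in> Y" "a \<notin> insert t (set p)" "b \<notin> insert t (set p)" "(a, b) \<in> E"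
      using XY[of "insert t (set p)"] by auto
    obtain b' a' where ba: "b' \<in> Y" "a' \<in> X" "b' \<notin> {a, b, t} \<union> set p" "a' \<notin> {a, b, t} \<union> set p"
      "(b', a') \<in> E"
      using YX[of "{a, b, t} \<union> set p"] by auto
    have neq: "a \<noteq> b" "b' \<noteq> a'" using ab(5) ba(5) \<open>irrefl E\<close> by (auto simp: irrefl_def)
    have "(b, t) \<in> E" "(t, b') \<in> E" using EY ab ba 3 by auto
    then have "dipath E [a, b, t, b', a']" using ab ba neq by (auto simp: dipath_def)
    then have "dipath E (p @ [a, b, t, b', a'])"
      using p ab ba 3 last_p[of a] by (auto simp: dipath_append)
    then show ?thesis using p ab ba 3 by (intro exI[of _ "[a, b, t, b', a']"]) auto
  qed
qed (auto simp: dipath_def)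

section \<open>Counting with upper densities\<close>

text \<open>
  With \<open>k\<close> sets, \<open>k < r\<close>, the union covers a proportion of at most \<open>k q\<close> of a long initial segment,
  for every \<open>q > 1 / r\<close>; the value \<open>q = 1 / (r - 1/2)\<close> makes this less than \<open>1\<close>.
\<close>

lemma density_cover:
  assumes "r \<ge> 1" "finite I" "finite F"
    and cover: "KN_verts \<subseteq> F \<union> (\<Union>i\<in>I. A i)"
    and dens: "\<And>i. i \<in> I \<Longrightarrow> upper_density (A i) \<le> ereal (1 / real r)"
  shows "r \<le> card I"
proof (rule ccontr)
  assume "\<not> r \<le> card I"
  then have less: "real (card I) \<le> real r - 1" by linarith
  define q where "q = 1 / (real r - 1/2)"
  have q: "1 / real r < q" unfolding q_def using \<open>r \<ge> 1\<close> by (intro divide_strict_left_mono) auto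
  have "real (card I) * q < 1" unfolding q_def using less \<open>r \<ge> 1\<close> by (simp add: field_simps)
  then have \<delta>: "0 < 1 - real (card I) * q" by simp
  have ev: "eventually (\<lambda>n. ereal (real (card (A i \<inter> {1..n})) / real n) < ereal q) sequentially"
    if "i \<in> I" for i
  proof (rule Limsup_lessD)
    show "limsup (\<lambda>n. ereal (real (card (A i \<inter> {1..n})) / real n)) < ereal q"
      using dens[OF that] q unfolding upper_density_def by (meson le_less_trans less_ereal.simps(1))
  qed
  have "eventually (\<lambda>n. \<forall>i\<in>I. real (card (A i \<inter> {1..n})) / real n < q) sequentially"
    using ev \<open>finite I\<close> by (auto intro!: eventually_ball_finite)
  then obtain N where N: "\<And>n i. n \<ge> N \<Longrightarrow> i \<in> I \<Longrightarrow> real (card (A i \<inter> {1..n})) / real n < q"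
    unfolding eventually_sequentially by blast
  obtain M where M: "real (card F) < real M * (1 - real (card I) * q)"
    using reals_Archimedean3[OF \<delta>] by blast
  define n where "n = max (max N M) 1"
  have n: "n \<ge> N" "n \<ge> M" "n \<ge> 1" unfolding n_def by auto
  have "{1..n} \<subseteq> F \<union> (\<Union>i\<in>I. A i \<inter> {1..n})" using cover unfolding KN_verts_def by fastforce
  then have "card {1..n} \<le> card (F \<union> (\<Union>i\<in>I. A i \<inter> {1..n}))"
    using assms by (intro card_mono) auto
  also have "\<dots> \<le> card F + card (\<Union>i\<in>I. A i \<inter> {1..n})" by (rule card_Un_le)
  also have "\<dots> \<le> card F + (\<Sum>i\<in>I. card (A i \<inter> {1..n}))"
    using card_UN_le[OF \<open>finite I\<close>] by (rule add_left_mono)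
  finally have "real n \<le> real (card F) + (\<Sum>i\<in>I. real (card (A i \<inter> {1..n})))"
    by (simp flip: of_nat_sum of_nat_add)
  also have "(\<Sum>i\<in>I. real (card (A i \<inter> {1..n}))) \<le> (\<Sum>i\<in>I. q * real n)"
  proof (rule sum_mono)
    fix i assume "i \<in> I"
    then show "real (card (A i \<inter> {1..n})) \<le> q * real n"
      using N[of n i] n by (simp add: field_simps)
  qed
  finally have "real n * (1 - real (card I) * q) \<le> real (card F)" by (simp add: algebra_simps)
  moreover have "real M * (1 - real (card I) * q) \<le> real n * (1 - real (card I) * q)"
    using n \<delta> by (intro mult_right_mono) auto
  ultimately show False using M by linarith
qed

section \<open>Blow-ups of tournaments without long paths\<close>

text \<open>Infinite parts leave room for a path through any walk of parts, even one with repetitions.\<close>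

lemma path_through_parts:
  assumes "successively (\<lambda>i j. W i \<times> W j \<subseteq> E) ks"
    and "\<And>k. k \<in> set ks \<Longrightarrow> infinite (W k)" and "finite F"
  shows "\<exists>p. dipath E p \<and> list_all2 (\<lambda>x k. x \<in> W k) p ks \<and> set p \<inter> F = {}"
  using assms(1,2)
proof (induction ks)
  case Nil
  then show ?case by (auto simp: dipath_def)
next
  case (Cons k ks)
  then obtain p where p: "dipath E p" "list_all2 (\<lambda>x k. x \<in> W k) p ks" "set p \<inter> F = {}"
    by (auto simp: successively_Cons)
  have "infinite (W k - (F \<union> set p))" using Cons.prems(2)[of k] \<open>finite F\<close> by simp
  then obtain x where x: "x \<in> W k" "x \<notin> F" "x \<notin> set p"
    by (metis Diff_iff UnI1 UnI2 ex_in_conv finite.emptyI)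
  have "(x, hd p) \<in> E" if "p \<noteq> []"
    using that p(2) x(1) Cons.prems(1) by (cases p; cases ks) auto
  then have "dipath E (x # p)" using p(1) x(3) by (auto simp: dipath_def successively_Cons)
  then show ?case using p x by (intro exI[of _ "x # p"]) auto
qed

lemma sorted_list_of_acyclic_total:
  assumes "wf T" "finite A" "\<And>i j. i \<in> A \<Longrightarrow> j \<in> A \<Longrightarrow> i \<noteq> j \<Longrightarrow> (i, j) \<in> T \<or> (j, i) \<in> T"
  shows "\<exists>L. set L = A \<and> distinct L \<and> sorted_wrt (\<lambda>i j. (i, j) \<in> T) L"
  using assms(2,3)
proof (induction A rule: finite_psubset_induct)
  case (psubset A)
  show ?case
  proof (cases "A = {}")
    case False
    then obtain m where m: "m \<in> A" "\<And>y. (y, m) \<in> T \<Longrightarrow> y \<notin> A"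
      using wfE_min[OF \<open>wf T\<close>] by (metis ex_in_conv)
    obtain L where L: "set L = A - {m}" "distinct L" "sorted_wrt (\<lambda>i j. (i, j) \<in> T) L"
      using psubset.IH[of "A - {m}"] psubset.prems m(1) by blast
    have "(m, y) \<in> T" if "y \<in> A - {m}" for y using psubset.prems[of m y] m that by blast
    then show ?thesis using L m(1) by (intro exI[of _ "m # L"]) auto
  qed auto
qed

text \<open>Going round a cycle repeatedly gives walks of every length.\<close>

lemma acyclic_if_relpow_empty:
  assumes "T ^^ n = {}"
  shows "acyclic T"
proof (rule acyclicI, intro allI notI)
  fix x assume "(x, x) \<in> T\<^sup>+"
  then obtain k where k: "k > 0" "(x, x) \<in> T ^^ k" by (auto simp: trancl_power)
  have "\<exists>y. (x, y) \<in> T ^^ m" for m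
  proof -
    have "(x, x) \<in> T ^^ (k * m)" for m
      by (induction m) (use k in \<open>auto simp: relpow_add\<close>)
    moreover have "k * m = m + (k * m - m)" using k(1) by simp
    ultimately have "(x, x) \<in> T ^^ m O T ^^ (k * m - m)" by (metis relpow_add)
    then show ?thesis by blast
  qed
  with assms show False by blast
qed

text \<open>
  Number the parts so that all edges from higher to lower parts are in \<open>E\<close>. If also
  \<open>(x, y) \<in> E\<close> with \<open>x\<close> in a lower part than \<open>y\<close>, then a path can descend to \<open>x\<close>, jump up to \<open>y\<close>, and
  continue from \<open>y\<close> into the part of \<open>x\<close> again and down to the lowest part: it has \<open>r + 2\<close> vertices.
\<close>

lemma red_blowup_is_transitive:
  fixes W :: "nat \<Rightarrow> 'a set"
  assumes bound: "\<And>p. dipath E p \<Longrightarrow> length p \<le> r"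
    and inf: "\<And>i. i < r \<Longrightarrow> infinite (W i)"
    and disj: "\<And>i j. i < r \<Longrightarrow> j < r \<Longrightarrow> i \<noteq> j \<Longrightarrow> W i \<inter> W j = {}"
    and tour: "\<And>i j. i < r \<Longrightarrow> j < r \<Longrightarrow> i \<noteq> j \<Longrightarrow> W i \<times> W j \<subseteq> E \<or> W j \<times> W i \<subseteq> E"
  shows "\<exists>\<sigma>. bij_betw \<sigma> {..<r} {1..r} \<and>
    (\<forall>i<r. \<forall>j<r. i \<noteq> j \<longrightarrow> (\<forall>x\<in>W i. \<forall>y\<in>W j. (x, y) \<in> E \<longleftrightarrow> \<sigma> j < \<sigma> i))"
proof -
  define T where "T = {(i, j). i < r \<and> j < r \<and> i \<noteq> j \<and> W i \<times> W j \<subseteq> E}"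
  \<comment> \<open>A tournament walk with \<open>r\<close> steps would lift to a path with \<open>r + 1\<close> vertices.\<close>
  have "T ^^ r = {}"
  proof (rule ccontr)
    assume "T ^^ r \<noteq> {}"
    then obtain e where "e \<in> T ^^ r" by blast
    then obtain s where s: "\<forall>i<r. (s i, s (Suc i)) \<in> T"
      by (cases e) (auto simp: relpow_fun_conv)
    show False
    proof (cases "r = 0")
      case True
      then show False using bound[of "[undefined]"] by (simp add: dipath_def)
    next
      case False
      have "s i < r" if "i \<le> r" for i
        using spec[OF s, of i] spec[OF s, of "i - 1"] that False by (cases "i = r") (auto simp: T_def)
      then have "infinite (W k)" if "k \<in> set (map s [0..<Suc r])" for k
        using that by (intro inf) (auto simp del: upt_Suc)
      moreover have "successively (\<lambda>i j. W i \<times> W j \<subseteq> E) (map s [0..<Suc r])"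
        by (rule successively_map_upt) (use s in \<open>force simp: T_def\<close>)
      ultimately obtain p where "dipath E p" "list_all2 (\<lambda>x k. x \<in> W k) p (map s [0..<Suc r])"
        using path_through_parts[of W E _ "{}"] by blast
      then show False using bound[of p] by (auto dest: list_all2_lengthD simp del: upt_Suc)
    qed
  qed
  then have "acyclic T" by (rule acyclic_if_relpow_empty)
  moreover have "finite T"
    by (rule finite_subset[of _ "{..<r} \<times> {..<r}"]) (auto simp: T_def)
  ultimately have "wf T" using finite_acyclic_wf by blast
  then obtain L where L: "set L = {..<r}" "distinct L" "sorted_wrt (\<lambda>i j. (i, j) \<in> T) L"
    using sorted_list_of_acyclic_total[of T "{..<r}"] tour unfolding T_def by auto
  have len: "length L = r" using distinct_card[OF L(2)] L(1) by simp
  have L_less: "L ! a < r" if "a < r" for a using that L(1) len nth_mem by blast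
  have down: "W (L ! a) \<times> W (L ! b) \<subseteq> E" if "a < b" "b < r" for a b
    using sorted_wrt_nth_less[OF L(3), of a b] that len by (auto simp: T_def)
  have L_succ: "successively (\<lambda>i j. W i \<times> W j \<subseteq> E) L"
    using successively_if_sorted_wrt[OF L(3)] by (rule successively_mono) (auto simp: T_def)
  have no_up: "(x, y) \<notin> E" if ab: "a < b" "b < r" and xy: "x \<in> W (L ! b)" "y \<in> W (L ! a)" for a b x y
  proof
    assume E: "(x, y) \<in> E"
    have infL: "infinite (W k)" if "k \<in> set L" for k using that L(1) inf by blast
    have succ: "successively (\<lambda>i j. W i \<times> W j \<subseteq> E) (take b L)"
      "successively (\<lambda>i j. W i \<times> W j \<subseteq> E) (drop b L)"
      using L_succ successively_append_iff[of _ "take b L" "drop b L"] by simp_all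
    have "\<exists>p. dipath E p \<and> list_all2 (\<lambda>x k. x \<in> W k) p (take b L) \<and> set p \<inter> {x, y} = {}"
      by (rule path_through_parts[OF succ(1)]) (rule infL, erule in_set_takeD, simp)
    then obtain p where p: "dipath E p" "list_all2 (\<lambda>x k. x \<in> W k) p (take b L)"
      "set p \<inter> {x, y} = {}" by blast
    have "\<exists>q. dipath E q \<and> list_all2 (\<lambda>x k. x \<in> W k) q (drop b L) \<and>
        set q \<inter> ({x, y} \<union> set p) = {}"
      by (rule path_through_parts[OF succ(2)]) (rule infL, erule in_set_dropD, simp)
    then obtain q where q: "dipath E q" "list_all2 (\<lambda>x k. x \<in> W k) q (drop b L)"
      "set q \<inter> ({x, y} \<union> set p) = {}" by blast
    have lens: "length p = b" "length q = r - b"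
      using p(2) q(2) len ab by (auto dest: list_all2_lengthD)
    have "p ! (b - 1) \<in> W (L ! (b - 1))"
      using list_all2_nthD[OF p(2), of "b - 1"] lens ab by simp
    then have px: "(last p, x) \<in> E"
      using down[of "b - 1" b] ab xy lens by (subst last_conv_nth) auto
    have "q ! 0 \<in> W (L ! b)" using list_all2_nthD[OF q(2), of 0] lens ab len by simp
    then have yq: "(y, hd q) \<in> E" using down[OF ab] xy lens ab by (subst hd_conv_nth) auto
    have "x \<noteq> y"
      using disj[of "L ! a" "L ! b"] L_less ab xy nth_eq_iff_index_eq[OF L(2), of a b] len by auto
    then have "dipath E [x, y]" using E by (simp add: dipath_def)
    then have "dipath E ([x, y] @ q)" using q yq by (subst dipath_append) auto
    then have "dipath E (p @ [x, y] @ q)" using p q px by (subst dipath_append) auto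
    from bound[OF this] show False using lens ab by simp
  qed
  have bij_L: "bij_betw ((!) L) {..<r} {..<r}" using bij_betw_nth[OF L(2)] L(1) len by blast
  define ix where "ix = the_inv_into {..<r} ((!) L)"
  have ix: "bij_betw ix {..<r} {..<r}" unfolding ix_def using bij_betw_the_inv_into[OF bij_L] .
  have L_ix: "L ! ix i = i" if "i < r" for i
    unfolding ix_def using f_the_inv_into_f_bij_betw[OF bij_L] that by simp
  have ix_less: "ix i < r" if "i < r" for i using bij_betwE[OF ix] that by auto
  have "bij_betw (\<lambda>a. r - a) {..<r} {1..r}"
    by (rule bij_betwI[where g = "\<lambda>a. r - a"]) auto
  from bij_betw_trans[OF ix this] have "bij_betw (\<lambda>i. r - ix i) {..<r} {1..r}"
    by (simp add: comp_def)
  moreover have "(x, y) \<in> E \<longleftrightarrow> r - ix j < r - ix i"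
    if ij: "i < r" "j < r" "i \<noteq> j" and xy: "x \<in> W i" "y \<in> W j" for i j x y
  proof -
    have "ix i \<noteq> ix j" using L_ix ij by metis
    then consider "ix i < ix j" | "ix j < ix i" by linarith
    then show ?thesis
    proof cases
      case 1
      then show ?thesis using down[OF 1 ix_less] L_ix ij xy ix_less[of i] by auto
    next
      case 2
      then show ?thesis using no_up[OF 2 ix_less, of x y] L_ix ij xy by auto
    qed
  qed
  ultimately show ?thesis by blast
qed

section \<open>Recognising the extremal colouring\<close>

lemma infinite_residue_part:
  assumes "r \<ge> 1"
  shows "infinite (residue_part r i)"
proof (rule infinite_super)
  show "range (\<lambda>k. i + r * Suc k) \<subseteq> residue_part r i"
    using assms by (auto simp: residue_part_def KN_verts_def cong_def Suc_le_eq simp del: mult_Suc_right)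
  show "infinite (range (\<lambda>k. i + r * Suc k))"
    using assms by (intro range_inj_infinite) (auto simp: inj_def)
qed

lemma residue_part_unique:
  assumes "n \<in> residue_part r i" "n \<in> residue_part r j" "i \<in> {1..r}" "j \<in> {1..r}"
  shows "i = j"
proof -
  have "i mod r = j mod r" using assms(1,2) by (simp add: residue_part_def cong_def)
  then show ?thesis using assms(3,4) by (cases "i = r"; cases "j = r") auto
qed

lemma UN_residue_part:
  assumes "r \<ge> 1"
  shows "(\<Union>i\<in>{1..r}. residue_part r i) = KN_verts"
proof
  show "KN_verts \<subseteq> (\<Union>i\<in>{1..r}. residue_part r i)"
  proof
    fix n assume n: "n \<in> KN_verts"
    let ?i = "Suc ((n - 1) mod r)"
    have "[n = ?i] (mod r)"
      using n by (simp add: cong_def mod_Suc_eq KN_verts_def)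
    moreover have "?i \<in> {1..r}" using assms by (simp add: Suc_le_eq)
    ultimately show "n \<in> (\<Union>i\<in>{1..r}. residue_part r i)"
      using n unfolding residue_part_def by blast
  qed
qed (auto simp: residue_part_def)

lemma c_r_eq_Red_iff:
  assumes "m \<in> residue_part r i" "n \<in> residue_part r j" "i \<in> {1..r}" "j \<in> {1..r}"
  shows "c_r r (m, n) = Red \<longleftrightarrow> j < i"
proof -
  have "(\<exists>k\<in>{1..r}. \<exists>l\<in>{1..r}. m \<in> residue_part r l \<and> n \<in> residue_part r k \<and> k < l) \<longleftrightarrow> j < i"
    using assms residue_part_unique by metis
  then show ?thesis unfolding c_r_def by simp
qed

lemma colour_isomorphic_c_rI:
  assumes "r \<ge> 1"
    and h: "\<And>v. v \<in> V \<Longrightarrow> h v \<in> {1..r}"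
    and inf: "\<And>i. i \<in> {1..r} \<Longrightarrow> infinite {v \<in> V. h v = i}"
    and red: "\<And>x y. x \<in> V \<Longrightarrow> y \<in> V \<Longrightarrow> x \<noteq> y \<Longrightarrow> c (x, y) = Red \<longleftrightarrow> h y < h x"
  shows "colour_isomorphic V c KN_verts (c_r r)"
proof -
  have "\<exists>\<psi>. bij_betw \<psi> {v \<in> V. h v = i} (residue_part r i)" if "i \<in> {1..r}" for i
    using bij_betw_trans[OF bij_betw_inv_into[OF bij_enumerate[OF inf[OF that]]]
        bij_enumerate[OF infinite_residue_part[OF \<open>r \<ge> 1\<close>]]] by blast
  then obtain \<psi> where
    \<psi>: "\<And>i. i \<in> {1..r} \<Longrightarrow> bij_betw (\<psi> i) {v \<in> V. h v = i} (residue_part r i)"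
    by metis
  define \<phi> where "\<phi> v = \<psi> (h v) v" for v
  have fibre: "bij_betw \<phi> {v \<in> V. h v = i} (residue_part r i)" if "i \<in> {1..r}" for i
    using \<psi>[OF that] by (rule iffD1[OF bij_betw_cong, rotated]) (simp add: \<phi>_def)
  have "bij_betw \<phi> (\<Union>i\<in>{1..r}. {v \<in> V. h v = i}) (\<Union>i\<in>{1..r}. residue_part r i)"
  proof (rule bij_betw_UNION_disjoint)
    show "disjoint_family_on (residue_part r) {1..r}"
      unfolding disjoint_family_on_def using residue_part_unique by blast
  qed (rule fibre)
  moreover have "(\<Union>i\<in>{1..r}. {v \<in> V. h v = i}) = V" using h by auto
  ultimately have "bij_betw \<phi> V KN_verts" using UN_residue_part[OF \<open>r \<ge> 1\<close>] by simp
  moreover have "c (x, y) = c_r r (\<phi> x, \<phi> y)" if "x \<in> V" "y \<in> V" "x \<noteq> y" for x y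
  proof -
    have "\<phi> x \<in> residue_part r (h x)" "\<phi> y \<in> residue_part r (h y)"
      using that h bij_betwE[OF fibre] by blast+
    then have "c_r r (\<phi> x, \<phi> y) = Red \<longleftrightarrow> c (x, y) = Red"
      using c_r_eq_Red_iff red that h by blast
    then show ?thesis by (cases "c (x, y)"; cases "c_r r (\<phi> x, \<phi> y)") auto
  qed
  ultimately show ?thesis unfolding colour_isomorphic_def by blast
qed

section \<open>The structure of the colouring\<close>

definition colour_edges :: "colouring \<Rightarrow> colour \<Rightarrow> (nat \<times> nat) set"
  where "colour_edges c x = {e \<in> KN_edges. c e = x}"

lemma directed_path_of_sequence:
  assumes "s ` {i. enat i \<le> N} \<subseteq> KN_verts" and "inj_on s {i. enat i \<le> N}"
    and "\<And>i. enat i < N \<Longrightarrow> (s i, s (Suc i)) \<in> colour_edges c x"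
  shows "\<exists>P. directed_path P \<and> path_has_colour c x P \<and> plength P = N \<and>
    path_verts P = s ` {i. enat i \<le> N}"
proof -
  let ?P = "\<lparr>plength = N, pvert = s, pedge = (\<lambda>i. (s i, s (Suc i)))\<rparr>"
  have "directed_path ?P" "path_has_colour c x ?P"
    using assms
    by (auto simp: directed_path_def is_path_def path_verts_def path_has_colour_def colour_edges_def)
  moreover have "plength ?P = N" "path_verts ?P = s ` {i. enat i \<le> N}"
    by (simp_all add: path_verts_def)
  ultimately show ?thesis by blast
qed

lemma red_path_bound:
  assumes "r \<ge> 1"
    and no_red: "\<not> (\<exists>P. directed_path P \<and> path_has_colour c Red P \<and> plength P = enat r)"
    and p: "dipath (colour_edges c Red) p"
  shows "length p \<le> r"
proof (rule ccontr)
  assume "\<not> length p \<le> r"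
  then have long: "r < length p" by simp
  have edge: "(p ! i, p ! Suc i) \<in> colour_edges c Red" if "i < r" for i
    using p successively_nthD[of _ p i] that long by (auto simp: dipath_def)
  have "p ! i \<in> KN_verts" if "i \<le> r" for i
    using edge[of i] edge[of "i - 1"] that \<open>r \<ge> 1\<close>
    by (cases "i < r") (auto simp: colour_edges_def KN_edges_def)
  moreover have "inj_on ((!) p) {i. enat i \<le> enat r}"
    using p long by (intro inj_on_nth) (auto simp: dipath_def)
  ultimately show False
    using directed_path_of_sequence[of "(!) p" "enat r" c Red] edge no_red by auto
qed

theorem theorem1p4:
  fixes r :: nat and c :: colouring
  assumes "r \<ge> 1"
    and no_red: "\<not> (\<exists>P. directed_path P \<and> path_has_colour c Red P \<and> plength P = enat r)"
    and blue_density: "\<forall>P. directed_path P \<and> path_has_colour c Blue P \<longrightarrow>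
      upper_density (path_verts P) \<le> ereal (1 / real r)"
  shows "\<exists>U. finite U \<and> U \<subseteq> KN_verts \<and> colour_isomorphic (KN_verts - U) c KN_verts (c_r r)"
proof -
  let ?R = "colour_edges c Red" and ?B = "colour_edges c Blue"
  have irrefl: "irrefl (colour_edges c x)" for x
    by (auto simp: irrefl_def colour_edges_def KN_edges_def)
  have blue_iff: "(x, y) \<in> ?B \<longleftrightarrow> (x, y) \<notin> ?R"
    if "x \<in> KN_verts" "y \<in> KN_verts" "x \<noteq> y" for x y
    using that by (cases "c (x, y)") (auto simp: colour_edges_def KN_edges_def)
  note bound = red_path_bound[OF \<open>r \<ge> 1\<close> no_red]
  obtain f where f: "\<And>v. f v < r" and proper: "\<And>u v. (u, v) \<in> ?R \<Longrightarrow> f u \<noteq> f v"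
    using gallai_roy[of ?R r, OF irrefl] bound by blast
  define V where "V k = {v \<in> KN_verts. f v = k}" for k
  have V_sub: "V k \<subseteq> KN_verts" for k by (auto simp: V_def)
  have V_cover: "KN_verts = (\<Union>k<r. V k)" using f by (auto simp: V_def)
  have V_blue: "(x, y) \<in> ?B" if "x \<in> V k" "y \<in> V k" "x \<noteq> y" for x y k
    using that proper[of x y] blue_iff by (auto simp: V_def)

  have ray_density: "upper_density (X \<union> Y) \<le> ereal (1 / real r)"
    if XY: "infinite X" "X \<subseteq> KN_verts" "Y \<subseteq> KN_verts"
      "\<And>x y. x \<in> X \<Longrightarrow> y \<in> X \<Longrightarrow> x \<noteq> y \<Longrightarrow> (x, y) \<in> ?B"
      "\<And>x y. x \<in> Y \<Longrightarrow> y \<in> Y \<Longrightarrow> x \<noteq> y \<Longrightarrow> (x, y) \<in> ?B"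
      "\<And>F. finite F \<Longrightarrow> \<exists>x\<in>X - F. \<exists>y\<in>Y - F. (x, y) \<in> ?B"
      "\<And>F. finite F \<Longrightarrow> \<exists>y\<in>Y - F. \<exists>x\<in>X - F. (y, x) \<in> ?B" for X Y
  proof -
    obtain h where h: "inj h" "range h = X \<union> Y" "\<And>i. (h i, h (Suc i)) \<in> ?B"
      using crossing_ray[OF XY(1) irrefl XY(4-7)] by blast
    obtain P where "directed_path P" "path_has_colour c Blue P" "path_verts P = X \<union> Y"
      using directed_path_of_sequence[of h \<infinity> c Blue] h XY(2,3) by auto
    with blue_density show ?thesis by metis
  qed

  \<comment> \<open>A ray through a single class is the case \<open>X = Y\<close> of a crossing ray.\<close>
  have V_density: "upper_density (V k) \<le> ereal (1 / real r)" if inf: "infinite (V k)" for k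
  proof -
    have "\<exists>x\<in>V k - F. \<exists>y\<in>V k - F. (x, y) \<in> ?B" if F: "finite F" for F
    proof -
      obtain x where x: "x \<in> V k - F"
        using infinite_imp_nonempty[OF Diff_infinite_finite[OF F inf]] by blast
      obtain y where "y \<in> V k - insert x F"
        using infinite_imp_nonempty[OF Diff_infinite_finite[OF finite.insertI[OF F, of x] inf]] by blast
      with x V_blue show ?thesis by blast
    qed
    then show ?thesis using ray_density[of "V k" "V k"] inf V_sub V_blue by simp
  qed

  \<comment> \<open>Finite classes could be discarded, and fewer than \<open>r\<close> sets would cover the rest.\<close>
  have V_inf: "infinite (V k)" if "k < r" for k
  proof
    assume fin: "finite (V k)"
    let ?I = "{k. k < r \<and> infinite (V k)}" and ?F = "\<Union>k\<in>{k. k < r \<and> finite (V k)}. V k"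
    have "r \<le> card ?I"
    proof (rule density_cover[OF \<open>r \<ge> 1\<close>])
      show "KN_verts \<subseteq> ?F \<union> (\<Union>k\<in>?I. V k)" using V_cover by blast
    qed (use V_density in auto)
    also have "card ?I < card {..<r}"
      using that fin by (intro psubset_card_mono) auto
    finally show False by simp
  qed

  \<comment> \<open>
    Otherwise a blue ray exhausts \<open>V i \<union> V j\<close>, and merging these two classes leaves \<open>r - 1\<close> sets
    of upper density at most \<open>1 / r\<close>.
  \<close>
  have sep: "\<exists>F. finite F \<and> ((V i - F) \<times> (V j - F) \<subseteq> ?R \<or> (V j - F) \<times> (V i - F) \<subseteq> ?R)"
    if ij: "i < r" "j < r" "i \<noteq> j" for i j
  proof (rule ccontr)
    assume no_F: "\<not> ?thesis"
    have neq: "x \<noteq> y" if "x \<in> V i" "y \<in> V j" for x y using that ij by (auto simp: V_def)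
    have cross: "\<exists>x\<in>V i - F. \<exists>y\<in>V j - F. (x, y) \<in> ?B" "\<exists>y\<in>V j - F. \<exists>x\<in>V i - F. (y, x) \<in> ?B"
      if F: "finite F" for F
    proof -
      obtain x y where xy: "x \<in> V i - F" "y \<in> V j - F" "(x, y) \<notin> ?R"
        using no_F F by (meson mem_Sigma_iff subrelI)
      then have "(x, y) \<in> ?B" using blue_iff[of x y] neq V_sub by blast
      with xy show "\<exists>x\<in>V i - F. \<exists>y\<in>V j - F. (x, y) \<in> ?B" by blast
      obtain u v where uv: "u \<in> V j - F" "v \<in> V i - F" "(u, v) \<notin> ?R"
        using no_F F by (meson mem_Sigma_iff subrelI)
      then have "(u, v) \<in> ?B" using blue_iff[of u v] neq[of v u] V_sub by blast
      with uv show "\<exists>y\<in>V j - F. \<exists>x\<in>V i - F. (y, x) \<in> ?B" by blast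
    qed
    have union: "upper_density (V i \<union> V j) \<le> ereal (1 / real r)"
      by (rule ray_density[OF V_inf[OF ij(1)] V_sub V_sub V_blue V_blue cross])
    have "r \<le> card ({..<r} - {j})"
    proof (rule density_cover[OF \<open>r \<ge> 1\<close>, where F = "{}" and A = "V(i := V i \<union> V j)"])
      show "KN_verts \<subseteq> {} \<union> (\<Union>k\<in>{..<r} - {j}. (V(i := V i \<union> V j)) k)"
      proof
        fix v assume "v \<in> KN_verts"
        then have v: "v \<in> V (f v)" by (simp add: V_def)
        then have "v \<in> (V(i := V i \<union> V j)) (if f v = j then i else f v)" by auto
        moreover have "(if f v = j then i else f v) \<in> {..<r} - {j}" using f[of v] ij by auto
        ultimately show "v \<in> {} \<union> (\<Union>k\<in>{..<r} - {j}. (V(i := V i \<union> V j)) k)" by blast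
      qed
      show "upper_density ((V(i := V i \<union> V j)) k) \<le> ereal (1 / real r)" if "k \<in> {..<r} - {j}" for k
        using that union V_density V_inf by simp
    qed auto
    then show False using ij by simp
  qed
  define F where "F i j = (SOME F. finite F \<and>
    ((V i - F) \<times> (V j - F) \<subseteq> ?R \<or> (V j - F) \<times> (V i - F) \<subseteq> ?R))" for i j
  have F: "finite (F i j) \<and>
      ((V i - F i j) \<times> (V j - F i j) \<subseteq> ?R \<or> (V j - F i j) \<times> (V i - F i j) \<subseteq> ?R)"
    if "i < r" "j < r" "i \<noteq> j" for i j
    unfolding F_def by (rule someI_ex[OF sep[OF that]])
  define U where "U = (\<Union>i<r. \<Union>j\<in>{..<r} - {i}. F i j) \<inter> KN_verts"
  have U: "finite U" "U \<subseteq> KN_verts" using F by (auto simp: U_def)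
  define W where "W k = V k - U" for k
  have W_F: "W i \<subseteq> V i - F i j \<and> W j \<subseteq> V j - F i j" if "i < r" "j < r" "i \<noteq> j" for i j
    using that V_sub unfolding W_def U_def by blast
  have "\<exists>\<sigma>. bij_betw \<sigma> {..<r} {1..r} \<and>
    (\<forall>i<r. \<forall>j<r. i \<noteq> j \<longrightarrow> (\<forall>x\<in>W i. \<forall>y\<in>W j. (x, y) \<in> ?R \<longleftrightarrow> \<sigma> j < \<sigma> i))"
  proof (rule red_blowup_is_transitive)
    show "length p \<le> r" if "dipath ?R p" for p using bound[OF that] .
    show "infinite (W k)" if "k < r" for k
      unfolding W_def by (rule Diff_infinite_finite[OF U(1) V_inf[OF that]])
    show "W i \<inter> W j = {}" if "i \<noteq> j" for i j using that by (auto simp: W_def V_def)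
    show "W i \<times> W j \<subseteq> ?R \<or> W j \<times> W i \<subseteq> ?R" if "i < r" "j < r" "i \<noteq> j" for i j
      using F[OF that] W_F[OF that] by (meson Sigma_mono order_trans)
  qed
  then obtain \<sigma> where \<sigma>: "bij_betw \<sigma> {..<r} {1..r}"
    and red: "\<And>i j x y. i < r \<Longrightarrow> j < r \<Longrightarrow> i \<noteq> j \<Longrightarrow> x \<in> W i \<Longrightarrow> y \<in> W j \<Longrightarrow>
      (x, y) \<in> ?R \<longleftrightarrow> \<sigma> j < \<sigma> i" by blast
  have W_f: "v \<in> W (f v)" if "v \<in> KN_verts - U" for v using that by (simp add: W_def V_def)
  have "colour_isomorphic (KN_verts - U) c KN_verts (c_r r)"
  proof (rule colour_isomorphic_c_rI[OF \<open>r \<ge> 1\<close>])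
    show "\<sigma> (f v) \<in> {1..r}" for v using bij_betwE[OF \<sigma>] f by blast
    show "infinite {v \<in> KN_verts - U. \<sigma> (f v) = i}" if "i \<in> {1..r}" for i
    proof -
      have "i \<in> \<sigma> ` {..<r}" using bij_betw_imp_surj_on[OF \<sigma>] that by simp
      then obtain k where k: "k < r" "\<sigma> k = i" by auto
      then have "W k \<subseteq> {v \<in> KN_verts - U. \<sigma> (f v) = i}" by (auto simp: W_def V_def)
      moreover have "infinite (W k)"
        unfolding W_def by (rule Diff_infinite_finite[OF U(1) V_inf[OF k(1)]])
      ultimately show ?thesis by (rule infinite_super)
    qed
    show "c (x, y) = Red \<longleftrightarrow> \<sigma> (f y) < \<sigma> (f x)"
      if x: "x \<in> KN_verts - U" and y: "y \<in> KN_verts - U" and "x \<noteq> y" for x y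
    proof -
      have R: "c (x, y) = Red \<longleftrightarrow> (x, y) \<in> ?R"
        using that by (auto simp: colour_edges_def KN_edges_def)
      show ?thesis
      proof (cases "f x = f y")
        case True
        then show ?thesis using R proper[of x y] by auto
      next
        case False
        then show ?thesis using R red[OF f f _ W_f[OF x] W_f[OF y]] by simp
      qed
    qed
  qed
  with U show ?thesis by blast
qed

end
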